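(* Let $L, R$ be subsets of a group $G$ such that $(L,R)$ has the $2$S-Cayley property, and let $\Gamma=\mathrm{2SCay}(G;L,R)$. (a) $G_R\leq\mathrm{Aut}(\Gamma)$ if and only if $L^{-1}gR=L^{-1}Rg$ for each $g\in G$; and in this case $\Gamma=\mathrm{Cay}(G,L^{-1}R)$. (b) $G_L\leq\mathrm{Aut}(\Gamma)$ if and only if $L^{-1}gR=gL^{-1}R$ for each $g\in G$; and in this case $\Gamma\cong\mathrm{Cay}(G,R^{-1}L)$.
   Context: Let $G$ be a group with identity $e$; for $X\subseteq G$ and $g\in G$ write $X^{-1}=\{x^{-1}: x\in X\}$, $X^g=g^{-1}Xg$, and $XY=\{xy: x\in X, y\in Y\}$. For $\ell,r\in G$ let $\lambda_{\ell,r}$ be the permutation $g\mapsto \ell^{-1}gr$ of $G$. Set $G_R=\{\lambda_{e,g}: g\in G\}$ and $G_L=\{\lambda_{g,e}: g\in G\}$ (the right and left regular representations, subgroups of $\mathrm{Sym}(G)$). For non-empty subsets $L,R$ of $G$, the two-sided Cayley graph $\mathrm{2SCay}(G;L,R)$ is the directed graph with vertex set $G$ with an arc from $x$ to $y$ if and only if $y=\ell^{-1}xr$ for some $\ell\in L$, $r\in R$. If the adjacency relation is symmetric, it is regarded as an undirected graph. A pair $(L,R)$ of subsets of $G$ has the $2$S-Cayley property if both $L,R$ are non-empty and: (1) $L^{-1}gR=LgR^{-1}$ for each $g\in G$ (this makes the adjacency relation symmetric); (2) $L^g\cap R=\varnothing$ for each $g\in G$; (3) $(LL^{-1})^g\cap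 (RR^{-1})=\{e\}$ for each $g\in G$. For $S\subseteq G$ with $e\notin S$ and $S=S^{-1}$, the Cayley graph $\mathrm{Cay}(G,S)$ is the graph with vertex set $G$ such that $(x,y)$ is an arc iff $xy^{-1}\in S$. *)

theory Defs
  imports
    "HOL-Algebra.Coset"
    "HOL-Algebra.Bij"
    "Graph_Theory.Digraph_Isomorphism"
    "Graph_Theory.Pair_Digraph"
begin

definition set_conj :: "('a, 'm) monoid_scheme \<Rightarrow> 'a set \<Rightarrow> 'a \<Rightarrow> 'a set" where
  "set_conj G X g = (inv\<^bsub>G\<^esub> g <#\<^bsub>G\<^esub> X) #>\<^bsub>G\<^esub> g"

text \<open>Permutations of the group are, as in \<^const>\<open>BijGroup\<close>, extensional functions
  (undefined outside the carrier).\<close>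

definition two_sided_perm :: "('a, 'm) monoid_scheme \<Rightarrow> 'a \<Rightarrow> 'a \<Rightarrow> 'a \<Rightarrow> 'a" where
  "two_sided_perm G l r = (\<lambda>g\<in>carrier G. inv\<^bsub>G\<^esub> l \<otimes>\<^bsub>G\<^esub> g \<otimes>\<^bsub>G\<^esub> r)"

definition right_regular :: "('a, 'm) monoid_scheme \<Rightarrow> ('a \<Rightarrow> 'a) set" where
  "right_regular G = {two_sided_perm G \<one>\<^bsub>G\<^esub> g | g. g \<in> carrier G}"

definition left_regular :: "('a, 'm) monoid_scheme \<Rightarrow> ('a \<Rightarrow> 'a) set" where
  "left_regular G = {two_sided_perm G g \<one>\<^bsub>G\<^esub> | g. g \<in> carrier G}"

definition two_sided_cayley ::
    "('a, 'm) monoid_scheme \<Rightarrow> 'a set \<Rightarrow> 'a set \<Rightarrow> 'a pair_pre_digraph" where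
  "two_sided_cayley G L R =
     \<lparr> pverts = carrier G,
       parcs = {(x, y). x \<in> carrier G \<and> y \<in> carrier G \<and>
                  (\<exists>l\<in>L. \<exists>r\<in>R. y = inv\<^bsub>G\<^esub> l \<otimes>\<^bsub>G\<^esub> x \<otimes>\<^bsub>G\<^esub> r)} \<rparr>"

definition two_sided_cayley_property ::
    "('a, 'm) monoid_scheme \<Rightarrow> 'a set \<Rightarrow> 'a set \<Rightarrow> bool" where
  "two_sided_cayley_property G L R \<longleftrightarrow>
     L \<noteq> {} \<and> R \<noteq> {} \<and>
     (\<forall>g\<in>carrier G.
        (set_inv\<^bsub>G\<^esub> L #>\<^bsub>G\<^esub> g) <#>\<^bsub>G\<^esub> R = (L #>\<^bsub>G\<^esub> g) <#>\<^bsub>G\<^esub> set_inv\<^bsub>G\<^esub> R) \<and>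
     (\<forall>g\<in>carrier G. set_conj G L g \<inter> R = {}) \<and>
     (\<forall>g\<in>carrier G.
        set_conj G (L <#>\<^bsub>G\<^esub> set_inv\<^bsub>G\<^esub> L) g \<inter> (R <#>\<^bsub>G\<^esub> set_inv\<^bsub>G\<^esub> R) = {\<one>\<^bsub>G\<^esub>})"

text \<open>A Cayley graph is only defined for a connection set as in the first definition below; the
  second one is total, so this side condition has to be stated wherever it is used. Undirected
  graphs are represented by symmetric digraphs.\<close>

definition connection_set :: "('a, 'm) monoid_scheme \<Rightarrow> 'a set \<Rightarrow> bool" where
  "connection_set G S \<longleftrightarrow> S \<subseteq> carrier G \<and> \<one>\<^bsub>G\<^esub> \<notin> S \<and> S = set_inv\<^bsub>G\<^esub> S"

definition cayley_graph :: "('a, 'm) monoid_scheme \<Rightarrow> 'a set \<Rightarrow> 'a pair_pre_digraph" where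
  "cayley_graph G S =
     \<lparr> pverts = carrier G,
       parcs = {(x, y). x \<in> carrier G \<and> y \<in> carrier G \<and> x \<otimes>\<^bsub>G\<^esub> inv\<^bsub>G\<^esub> y \<in> S} \<rparr>"

definition graph_Aut :: "'a pair_pre_digraph \<Rightarrow> ('a \<Rightarrow> 'a) monoid" where
  "graph_Aut \<Gamma> = (BijGroup (pverts \<Gamma>))
     \<lparr> carrier := {f \<in> Bij (pverts \<Gamma>). \<forall>x\<in>pverts \<Gamma>. \<forall>y\<in>pverts \<Gamma>.
                     (f x, f y) \<in> parcs \<Gamma> \<longleftrightarrow> (x, y) \<in> parcs \<Gamma>} \<rparr>"

end

theory Submission
  imports Defs
begin

text \<open>
  Write \<open>N(x) = L\<^sup>-\<^sup>1 x R\<close> for the set of out-neighbours of a vertex \<open>x\<close> of \<open>2SCay(G; L, R)\<close>.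
  A set of arcs on \<open>G\<close> is invariant under all right translations exactly when every
  out-neighbourhood is the right translate \<open>N(x) = N(e) x\<close> of the out-neighbourhood of the
  identity: one direction translates the arc \<open>(x, y)\<close> by \<open>x\<^sup>-\<^sup>1\<close>, the other uses that \<open>y
  x\<^sup>-\<^sup>1\<close> does not change when \<open>x\<close> and \<open>y\<close> are multiplied by the same element on the right
  (\<open>subgroup_right_regular_graph_Aut_iff\<close>). As \<open>N(e) = L\<^sup>-\<^sup>1 R\<close>, this is the criterion for the
  right regular representation. Left translations are treated in the same way, with \<open>N(x) = x
  N(e)\<close> and \<open>x\<^sup>-\<^sup>1 y\<close> (\<open>subgroup_left_regular_graph_Aut_iff\<close>).

  Put \<open>S = L\<^sup>-\<^sup>1 R\<close>. In either case \<open>S\<close> is a connection set: a common element of \<open>L\<close> and \<open>R\<close>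
  is excluded because the conjugates of \<open>L\<close> are disjoint from \<open>R\<close>, so \<open>e \<notin> S\<close>; and if \<open>s \<in> S\<close>,
  then \<open>(e, s)\<close> is an arc, hence so is \<open>(s, e)\<close> because \<open>L\<^sup>-\<^sup>1 g R = L g R\<^sup>-\<^sup>1\<close> for all \<open>g\<close>,
  and \<open>e \<in> N(s)\<close>, which is \<open>S s\<close> or \<open>s S\<close>, yields \<open>s\<^sup>-\<^sup>1 \<in> S\<close>.

  If the right translations are automorphisms, \<open>(x, y)\<close> is an arc iff \<open>y x\<^sup>-\<^sup>1 \<in> S\<close>, and
  taking inverses turns this into \<open>x y\<^sup>-\<^sup>1 \<in> S\<close>, the adjacency of the Cayley graph. If the
  left translations are, \<open>(x, y)\<close> is an arc iff \<open>x\<^sup>-\<^sup>1 y \<in> S\<close>, and inversion \<open>x \<mapsto> x\<^sup>-\<^sup>1\<close> is an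
  isomorphism onto the Cayley graph of \<open>S = S\<^sup>-\<^sup>1 = R\<^sup>-\<^sup>1 L\<close>.
\<close>

section \<open>Automorphisms and isomorphisms of pair digraphs\<close>

lemma BijGroup_simps:
  shows carrier_BijGroup: "carrier (BijGroup V) = Bij V"
    and mult_BijGroup: "f \<in> Bij V \<Longrightarrow> g \<in> Bij V \<Longrightarrow> f \<otimes>\<^bsub>BijGroup V\<^esub> g = compose V f g"
    and one_BijGroup: "\<one>\<^bsub>BijGroup V\<^esub> = (\<lambda>x\<in>V. x)"
  by (simp_all add: BijGroup_def)

lemma carrier_graph_Aut:
  "carrier (graph_Aut D) = {f \<in> Bij (pverts D). \<forall>x\<in>pverts D. \<forall>y\<in>pverts D.
     (f x, f y) \<in> parcs D \<longleftrightarrow> (x, y) \<in> parcs D}"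
  by (simp add: graph_Aut_def)

lemma graph_Aut_eq_BijGroup_update:
  "graph_Aut D = (BijGroup (pverts D))\<lparr>carrier := carrier (graph_Aut D)\<rparr>"
  by (simp add: graph_Aut_def)

lemma subgroup_carrier_graph_Aut:
  "subgroup (carrier (graph_Aut D)) (BijGroup (pverts D))"
proof -
  let ?V = "pverts D" and ?A = "carrier (graph_Aut D)"
  interpret B: group "BijGroup ?V" by (rule group_BijGroup)
  show ?thesis
  proof (rule B.subgroupI)
    show "?A \<subseteq> carrier (BijGroup ?V)"
      by (auto simp: carrier_graph_Aut BijGroup_simps)
    have "(\<lambda>x\<in>?V. x) \<in> ?A"
      by (simp add: carrier_graph_Aut id_Bij)
    then show "?A \<noteq> {}" by blast
  next
    fix f g assume "f \<in> ?A" "g \<in> ?A"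
    moreover from \<open>g \<in> ?A\<close> have "g x \<in> ?V" if "x \<in> ?V" for x
      using that by (simp add: carrier_graph_Aut funcset_mem[OF Bij_imp_funcset])
    ultimately show "f \<otimes>\<^bsub>BijGroup ?V\<^esub> g \<in> ?A"
      by (auto simp: carrier_graph_Aut BijGroup_simps compose_Bij compose_eq)
  next
    fix f assume f: "f \<in> ?A"
    let ?g = "inv\<^bsub>BijGroup ?V\<^esub> f"
    have fB: "f \<in> carrier (BijGroup ?V)"
      using f by (simp add: carrier_graph_Aut BijGroup_simps)
    then have gB: "?g \<in> Bij ?V"
      using B.inv_closed[OF fB] by (simp add: BijGroup_simps)
    then have gV: "?g x \<in> ?V" if "x \<in> ?V" for x
      using that by (rule funcset_mem[OF Bij_imp_funcset])
    have "compose ?V f ?g = (\<lambda>x\<in>?V. x)"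
      using B.r_inv[OF fB] fB gB by (simp add: BijGroup_simps)
    then have fg: "f (?g x) = x" if "x \<in> ?V" for x
      using that by (metis compose_eq restrict_apply')
    have "(?g x, ?g y) \<in> parcs D \<longleftrightarrow> (x, y) \<in> parcs D" if "x \<in> ?V" "y \<in> ?V" for x y
    proof -
      have "(f (?g x), f (?g y)) \<in> parcs D \<longleftrightarrow> (?g x, ?g y) \<in> parcs D"
        using f gV that by (simp add: carrier_graph_Aut)
      then show ?thesis using fg that by simp
    qed
    then show "?g \<in> ?A"
      using gB by (simp add: carrier_graph_Aut)
  qed
qed

text \<open>
  The automorphism group carries the operations of the symmetric group, so a permutation group
  lies in it as a subgroup as soon as each of its elements is an automorphism.
\<close>

lemma subgroup_graph_Aut_iff_subset:
  assumes "subgroup H (BijGroup (pverts D))"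
  shows "subgroup H (graph_Aut D) \<longleftrightarrow> H \<subseteq> carrier (graph_Aut D)"
proof
  assume "subgroup H (graph_Aut D)"
  then show "H \<subseteq> carrier (graph_Aut D)" by (rule subgroup.subset)
next
  assume "H \<subseteq> carrier (graph_Aut D)"
  with assms show "subgroup H (graph_Aut D)"
    by (subst graph_Aut_eq_BijGroup_update)
      (rule group.subgroup_incl[OF group_BijGroup _ subgroup_carrier_graph_Aut])
qed

text \<open>
  The arcs of a pair digraph are pairs of vertices, so the vertex map \<open>f\<close> already dictates the
  arc map \<open>map_prod f f\<close>.
\<close>

lemma digraph_iso_with_projI:
  assumes "pair_wf_digraph D" and "pair_wf_digraph E"
    and f: "bij_betw f (pverts D) (pverts E)"
    and arcs: "\<And>x y. x \<in> pverts D \<Longrightarrow> y \<in> pverts D \<Longrightarrow>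
      (f x, f y) \<in> parcs E \<longleftrightarrow> (x, y) \<in> parcs D"
  shows "digraph_iso (with_proj D) (with_proj E)"
proof -
  interpret D: pair_wf_digraph D by fact
  interpret E: pair_wf_digraph E by fact
  define h where "h = \<lparr> iso_verts = f, iso_arcs = map_prod f f, iso_head = snd, iso_tail = fst \<rparr>"
  have inj: "inj_on f (pverts D)" and img: "f ` pverts D = pverts E"
    using f by (auto simp: bij_betw_def)
  have "inj_on (map_prod f f) (pverts D \<times> pverts D)"
    using inj by (rule map_prod_inj_on[OF _ inj])
  moreover have "parcs D \<subseteq> pverts D \<times> pverts D"
    by (auto dest: D.wellformed')
  ultimately have "inj_on (map_prod f f) (parcs D)"
    by (rule inj_on_subset)
  then have "pre_digraph.digraph_isomorphism (with_proj D) h"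
    using inj D.wf_digraph_axioms
    by (auto simp: pre_digraph.digraph_isomorphism_def h_def)
  moreover have "map_prod f f ` parcs D = parcs E"
  proof (intro equalityI subsetI)
    fix a assume "a \<in> map_prod f f ` parcs D"
    then show "a \<in> parcs E"
      using arcs by (auto dest: D.wellformed')
  next
    fix a assume a: "a \<in> parcs E"
    obtain u v where uv: "a = (u, v)" by (cases a)
    with a obtain x y where "u = f x" "v = f y" "x \<in> pverts D" "y \<in> pverts D"
      using img by (metis E.wellformed' imageE)
    with a uv arcs show "a \<in> map_prod f f ` parcs D"
      by (auto intro!: image_eqI[of _ _ "(x, y)"])
  qed
  then have "with_proj E = app_iso h (with_proj D)"
    using img by (simp add: app_iso_def with_proj_def h_def)
  ultimately show ?thesis
    unfolding digraph_iso_def by blast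
qed

section \<open>Two-sided translations\<close>

context group
begin

lemma inv_cancel_left [simp]:
  assumes "x \<in> carrier G" "y \<in> carrier G"
  shows "x \<otimes> (inv x \<otimes> y) = y" and "inv x \<otimes> (x \<otimes> y) = y"
  using assms by (simp_all add: m_assoc[symmetric])

lemma two_sided_perm_apply [simp]:
  "x \<in> carrier G \<Longrightarrow> two_sided_perm G l r x = inv l \<otimes> x \<otimes> r"
  by (simp add: two_sided_perm_def)

text \<open>
  Functions compose from right to left, whereas both factors of \<open>two_sided_perm\<close> compose from
  left to right; hence the reversed products.
\<close>

lemma compose_two_sided_perm:
  assumes "l \<in> carrier G" "r \<in> carrier G" "l' \<in> carrier G" "r' \<in> carrier G"
  shows "compose (carrier G) (two_sided_perm G l r) (two_sided_perm G l' r') =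
    two_sided_perm G (l' \<otimes> l) (r' \<otimes> r)"
  using assms by (auto simp: compose_def two_sided_perm_def inv_mult_group m_assoc)

lemma two_sided_perm_one: "two_sided_perm G \<one> \<one> = (\<lambda>x\<in>carrier G. x)"
  by (auto simp: two_sided_perm_def)

lemma two_sided_perm_Bij:
  assumes "l \<in> carrier G" "r \<in> carrier G"
  shows "two_sided_perm G l r \<in> Bij (carrier G)"
proof -
  have "bij_betw (two_sided_perm G l r) (carrier G) (carrier G)"
  proof (rule bij_betw_byWitness[of _ "two_sided_perm G (inv l) (inv r)"])
    show "\<forall>x\<in>carrier G. two_sided_perm G (inv l) (inv r) (two_sided_perm G l r x) = x"
      and "\<forall>x\<in>carrier G. two_sided_perm G l r (two_sided_perm G (inv l) (inv r) x) = x"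
      using assms by (simp_all add: m_assoc)
    show "two_sided_perm G l r ` carrier G \<subseteq> carrier G"
      and "two_sided_perm G (inv l) (inv r) ` carrier G \<subseteq> carrier G"
      using assms by auto
  qed
  then show ?thesis
    by (simp add: Bij_def two_sided_perm_def)
qed

lemma subgroup_two_sided_perms:
  assumes H: "subgroup H G" and K: "subgroup K G"
  shows "subgroup {two_sided_perm G h k | h k. h \<in> H \<and> k \<in> K} (BijGroup (carrier G))"
    (is "subgroup ?P ?B")
proof -
  interpret B: group ?B by (rule group_BijGroup)
  have HG: "h \<in> carrier G" if "h \<in> H" for h using H that by (rule subgroup.mem_carrier)
  have KG: "k \<in> carrier G" if "k \<in> K" for k using K that by (rule subgroup.mem_carrier)
  have mult: "two_sided_perm G h k \<otimes>\<^bsub>?B\<^esub> two_sided_perm G h' k' =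
      two_sided_perm G (h' \<otimes> h) (k' \<otimes> k)" if "h \<in> H" "k \<in> K" "h' \<in> H" "k' \<in> K" for h k h' k'
    using that by (simp add: BijGroup_simps two_sided_perm_Bij compose_two_sided_perm HG KG)
  have PB: "two_sided_perm G h k \<in> carrier ?B" if "h \<in> H" "k \<in> K" for h k
    using that by (simp add: BijGroup_simps two_sided_perm_Bij HG KG)
  show ?thesis
  proof (rule B.subgroupI)
    show "?P \<subseteq> carrier ?B" using PB by blast
    show "?P \<noteq> {}" using subgroup.one_closed[OF H] subgroup.one_closed[OF K] by blast
  next
    fix f g assume "f \<in> ?P" "g \<in> ?P"
    then obtain h k h' k' where "f = two_sided_perm G h k" "g = two_sided_perm G h' k'"
      and "h \<in> H" "k \<in> K" "h' \<in> H" "k' \<in> K" by blast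
    then have "f \<otimes>\<^bsub>?B\<^esub> g = two_sided_perm G (h' \<otimes> h) (k' \<otimes> k)"
      and "h' \<otimes> h \<in> H" "k' \<otimes> k \<in> K"
      using mult subgroup.m_closed[OF H] subgroup.m_closed[OF K] by simp_all
    then show "f \<otimes>\<^bsub>?B\<^esub> g \<in> ?P" by blast
  next
    fix f assume "f \<in> ?P"
    then obtain h k where f: "f = two_sided_perm G h k" and hk: "h \<in> H" "k \<in> K" by blast
    have hk': "inv h \<in> H" "inv k \<in> K"
      using hk subgroup.m_inv_closed[OF H] subgroup.m_inv_closed[OF K] by auto
    have "two_sided_perm G (inv h) (inv k) \<otimes>\<^bsub>?B\<^esub> f = \<one>\<^bsub>?B\<^esub>"
      using mult[OF hk' hk] hk by (simp add: f HG KG two_sided_perm_one) (simp add: BijGroup_simps)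
    then have "inv\<^bsub>?B\<^esub> f = two_sided_perm G (inv h) (inv k)"
      using PB[OF hk] PB[OF hk'] by (simp add: f B.inv_equality)
    with hk' show "inv\<^bsub>?B\<^esub> f \<in> ?P" by blast
  qed
qed

lemma subgroup_right_regular: "subgroup (right_regular G) (BijGroup (carrier G))"
  using subgroup_two_sided_perms[OF triv_subgroup subgroup_self]
  by (simp add: right_regular_def)

lemma subgroup_left_regular: "subgroup (left_regular G) (BijGroup (carrier G))"
  using subgroup_two_sided_perms[OF subgroup_self triv_subgroup]
  by (simp add: left_regular_def)

text \<open>
  Right multiplication by \<open>inv x\<close> moves \<open>x\<close> to the identity, so a digraph with all right
  translations as automorphisms is determined by the arcs that leave the identity; conversely,
  the quotient \<open>y \<otimes> inv x\<close> is a right-translation invariant of the pair \<open>(x, y)\<close>.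
\<close>

lemma subgroup_right_regular_graph_Aut_iff:
  assumes V: "pverts D = carrier G"
  shows "subgroup (right_regular G) (graph_Aut D) \<longleftrightarrow>
    (\<forall>x\<in>carrier G. \<forall>y\<in>carrier G. (x, y) \<in> parcs D \<longleftrightarrow> (\<one>, y \<otimes> inv x) \<in> parcs D)"
    (is "_ \<longleftrightarrow> ?determined")
proof -
  have "subgroup (right_regular G) (graph_Aut D) \<longleftrightarrow> right_regular G \<subseteq> carrier (graph_Aut D)"
    using subgroup_right_regular by (intro subgroup_graph_Aut_iff_subset) (simp add: V)
  also have "\<dots> \<longleftrightarrow> (\<forall>g\<in>carrier G. \<forall>x\<in>carrier G. \<forall>y\<in>carrier G.
      (x \<otimes> g, y \<otimes> g) \<in> parcs D \<longleftrightarrow> (x, y) \<in> parcs D)" (is "_ \<longleftrightarrow> ?invariant")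
    by (auto simp: right_regular_def carrier_graph_Aut V two_sided_perm_Bij)
  also have "\<dots> \<longleftrightarrow> ?determined"
  proof
    assume inv: ?invariant
    show ?determined
    proof (intro ballI)
      fix x y assume "x \<in> carrier G" "y \<in> carrier G"
      then show "(x, y) \<in> parcs D \<longleftrightarrow> (\<one>, y \<otimes> inv x) \<in> parcs D"
        using inv[rule_format, of "inv x" x y] by simp
    qed
  next
    assume det: ?determined
    show ?invariant
    proof (intro ballI)
      fix g x y assume gxy: "g \<in> carrier G" "x \<in> carrier G" "y \<in> carrier G"
      then have "y \<otimes> g \<otimes> inv (x \<otimes> g) = y \<otimes> inv x"
        by (simp add: inv_mult_group m_assoc)
      then show "(x \<otimes> g, y \<otimes> g) \<in> parcs D \<longleftrightarrow> (x, y) \<in> parcs D"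
        using gxy det[rule_format, of x y] det[rule_format, of "x \<otimes> g" "y \<otimes> g"] by simp
    qed
  qed
  finally show ?thesis .
qed

text \<open>
  The mirror image for left translations: here \<open>inv x \<otimes> y\<close> is the invariant of the pair \<open>(x,
  y)\<close>.
\<close>

lemma subgroup_left_regular_graph_Aut_iff:
  assumes V: "pverts D = carrier G"
  shows "subgroup (left_regular G) (graph_Aut D) \<longleftrightarrow>
    (\<forall>x\<in>carrier G. \<forall>y\<in>carrier G. (x, y) \<in> parcs D \<longleftrightarrow> (\<one>, inv x \<otimes> y) \<in> parcs D)"
    (is "_ \<longleftrightarrow> ?determined")
proof -
  have "subgroup (left_regular G) (graph_Aut D) \<longleftrightarrow> left_regular G \<subseteq> carrier (graph_Aut D)"
    using subgroup_left_regular by (intro subgroup_graph_Aut_iff_subset) (simp add: V)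
  also have "\<dots> \<longleftrightarrow> (\<forall>g\<in>carrier G. \<forall>x\<in>carrier G. \<forall>y\<in>carrier G.
      (inv g \<otimes> x, inv g \<otimes> y) \<in> parcs D \<longleftrightarrow> (x, y) \<in> parcs D)" (is "_ \<longleftrightarrow> ?invariant")
    by (auto simp: left_regular_def carrier_graph_Aut V two_sided_perm_Bij)
  also have "\<dots> \<longleftrightarrow> ?determined"
  proof
    assume inv: ?invariant
    show ?determined
    proof (intro ballI)
      fix x y assume "x \<in> carrier G" "y \<in> carrier G"
      then show "(x, y) \<in> parcs D \<longleftrightarrow> (\<one>, inv x \<otimes> y) \<in> parcs D"
        using inv[rule_format, of x x y] by simp
    qed
  next
    assume det: ?determined
    show ?invariant
    proof (intro ballI)
      fix g x y assume gxy: "g \<in> carrier G" "x \<in> carrier G" "y \<in> carrier G"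
      then have "inv (inv g \<otimes> x) \<otimes> (inv g \<otimes> y) = inv x \<otimes> y"
        by (simp add: inv_mult_group m_assoc)
      then show "(inv g \<otimes> x, inv g \<otimes> y) \<in> parcs D \<longleftrightarrow> (x, y) \<in> parcs D"
        using gxy det[rule_format, of x y] det[rule_format, of "inv g \<otimes> x" "inv g \<otimes> y"] by simp
    qed
  qed
  finally show ?thesis .
qed

section \<open>Neighbourhoods in two-sided Cayley graphs\<close>

lemma mem_r_coset_iff:
  assumes "S \<subseteq> carrier G" "x \<in> carrier G" "y \<in> carrier G"
  shows "y \<in> S #> x \<longleftrightarrow> y \<otimes> inv x \<in> S"
proof
  assume "y \<in> S #> x"
  then show "y \<otimes> inv x \<in> S"
    using assms by (auto simp: r_coset_def m_assoc subset_iff)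
next
  assume "y \<otimes> inv x \<in> S"
  moreover have "y = y \<otimes> inv x \<otimes> x"
    using assms by (simp add: m_assoc)
  ultimately show "y \<in> S #> x"
    unfolding r_coset_def by blast
qed

lemma mem_l_coset_iff:
  assumes "S \<subseteq> carrier G" "x \<in> carrier G" "y \<in> carrier G"
  shows "y \<in> x <# S \<longleftrightarrow> inv x \<otimes> y \<in> S"
proof
  assume "y \<in> x <# S"
  then show "inv x \<otimes> y \<in> S"
    using assms by (auto simp: l_coset_def m_assoc[symmetric] subset_iff)
next
  assume "inv x \<otimes> y \<in> S"
  moreover have "y = x \<otimes> (inv x \<otimes> y)"
    using assms by (simp add: m_assoc[symmetric])
  ultimately show "y \<in> x <# S"
    unfolding l_coset_def by blast
qed

lemma set_inv_subset_carrier: "A \<subseteq> carrier G \<Longrightarrow> set_inv A \<subseteq> carrier G"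
  by (auto simp: SET_INV_def)

lemma set_inv_set_inv_mult:
  assumes "A \<subseteq> carrier G" "B \<subseteq> carrier G"
  shows "set_inv (set_inv A <#> B) = set_inv B <#> A"
proof -
  have "inv (inv a \<otimes> b) = inv b \<otimes> a" if "a \<in> A" "b \<in> B" for a b
    using that assms by (simp add: inv_mult_group subset_iff)
  then show ?thesis
    unfolding SET_INV_def set_mult_def by fastforce
qed

lemma set_inv_eqI:
  assumes "S \<subseteq> carrier G" and "\<And>s. s \<in> S \<Longrightarrow> inv s \<in> S"
  shows "set_inv S = S"
proof
  show "set_inv S \<subseteq> S" using assms by (auto simp: SET_INV_def)
  show "S \<subseteq> set_inv S"
  proof
    fix s assume "s \<in> S"
    then have "inv s \<in> S" "s = inv (inv s)" using assms by auto
    then show "s \<in> set_inv S" unfolding SET_INV_def by blast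
  qed
qed

lemma connection_set_inv_mem_iff:
  assumes "connection_set G T" "t \<in> carrier G"
  shows "inv t \<in> T \<longleftrightarrow> t \<in> T"
proof -
  have "inv u \<in> T" if "u \<in> T" for u
    using assms(1) that unfolding connection_set_def SET_INV_def by blast
  from this[of t] this[of "inv t"] assms(2) show ?thesis by auto
qed

lemma pverts_two_sided_cayley [simp]: "pverts (two_sided_cayley G L R) = carrier G"
  by (simp add: two_sided_cayley_def)

lemma pverts_cayley_graph [simp]: "pverts (cayley_graph G S) = carrier G"
  by (simp add: cayley_graph_def)

lemma pair_wf_two_sided_cayley: "pair_wf_digraph (two_sided_cayley G L R)"
  by unfold_locales (auto simp: two_sided_cayley_def)

lemma pair_wf_cayley_graph: "pair_wf_digraph (cayley_graph G S)"
  by unfold_locales (auto simp: cayley_graph_def)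

end

locale two_sided_connection = group G for G (structure) +
  fixes L R :: "'a set"
  assumes L: "L \<subseteq> carrier G" and R: "R \<subseteq> carrier G"
begin

abbreviation (input) \<Gamma> where "\<Gamma> \<equiv> two_sided_cayley G L R"

abbreviation (input) S where "S \<equiv> set_inv L <#> R"

lemma neighbours_subset:
  "x \<in> carrier G \<Longrightarrow> (set_inv L #> x) <#> R \<subseteq> carrier G"
  using L R by (intro set_mult_closed r_coset_subset_G set_inv_subset_carrier)

lemma arc_iff:
  assumes "x \<in> carrier G"
  shows "(x, y) \<in> parcs \<Gamma> \<longleftrightarrow> y \<in> (set_inv L #> x) <#> R"
  using neighbours_subset[OF assms] assms
  by (auto simp: two_sided_cayley_def r_coset_def set_mult_def SET_INV_def)

lemma S_subset: "S \<subseteq> carrier G"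
  using L R by (intro set_mult_closed set_inv_subset_carrier)

lemma arc_one_iff: "(\<one>, y) \<in> parcs \<Gamma> \<longleftrightarrow> y \<in> S"
  using L by (simp add: arc_iff set_inv_subset_carrier)

lemma right_regular_iff_arcs:
  "subgroup (right_regular G) (graph_Aut \<Gamma>) \<longleftrightarrow>
    (\<forall>x\<in>carrier G. \<forall>y\<in>carrier G. (x, y) \<in> parcs \<Gamma> \<longleftrightarrow> y \<otimes> inv x \<in> S)"
  by (simp add: subgroup_right_regular_graph_Aut_iff arc_one_iff)

lemma left_regular_iff_arcs:
  "subgroup (left_regular G) (graph_Aut \<Gamma>) \<longleftrightarrow>
    (\<forall>x\<in>carrier G. \<forall>y\<in>carrier G. (x, y) \<in> parcs \<Gamma> \<longleftrightarrow> inv x \<otimes> y \<in> S)"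
  by (simp add: subgroup_left_regular_graph_Aut_iff arc_one_iff)

lemma right_regular_iff:
  "subgroup (right_regular G) (graph_Aut \<Gamma>) \<longleftrightarrow>
    (\<forall>g\<in>carrier G. (set_inv L #> g) <#> R = S #> g)"
proof -
  have "(set_inv L #> g) <#> R = S #> g \<longleftrightarrow>
      (\<forall>y\<in>carrier G. (g, y) \<in> parcs \<Gamma> \<longleftrightarrow> y \<otimes> inv g \<in> S)" if g: "g \<in> carrier G" for g
    using neighbours_subset[OF g] r_coset_subset_G[OF S_subset g] mem_r_coset_iff[OF S_subset g]
      arc_iff[OF g] by blast
  then show ?thesis by (simp add: right_regular_iff_arcs)
qed

lemma left_regular_iff:
  "subgroup (left_regular G) (graph_Aut \<Gamma>) \<longleftrightarrow>
    (\<forall>g\<in>carrier G. (set_inv L #> g) <#> R = (g <# set_inv L) <#> R)"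
proof -
  have "(set_inv L #> g) <#> R = (g <# set_inv L) <#> R \<longleftrightarrow>
      (\<forall>y\<in>carrier G. (g, y) \<in> parcs \<Gamma> \<longleftrightarrow> inv g \<otimes> y \<in> S)" if g: "g \<in> carrier G" for g
  proof -
    have "(g <# set_inv L) <#> R = g <# S"
      using L R g by (simp add: l_coset_eq_set_mult set_mult_assoc set_inv_subset_carrier)
    then show ?thesis
      using neighbours_subset[OF g] l_coset_subset_G[OF S_subset g] mem_l_coset_iff[OF S_subset g]
        arc_iff[OF g] by blast
  qed
  then show ?thesis by (simp add: left_regular_iff_arcs)
qed

text \<open>
  Solving \<open>y = inv l \<otimes> x \<otimes> r\<close> for \<open>x\<close> puts \<open>x\<close> into \<open>L y R\<^sup>-\<^sup>1\<close>, and \<open>L\<^sup>-\<^sup>1 g R = L g R\<^sup>-\<^sup>1\<close>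
  at \<open>g = y\<close> identifies this with the set of out-neighbours of \<open>y\<close>.
\<close>

lemma arc_sym:
  assumes P: "two_sided_cayley_property G L R" and xy: "(x, y) \<in> parcs \<Gamma>"
  shows "(y, x) \<in> parcs \<Gamma>"
proof -
  obtain l r where lr: "l \<in> L" "r \<in> R" "y = inv l \<otimes> x \<otimes> r" and x: "x \<in> carrier G" and y: "y \<in> carrier G"
    using xy by (auto simp: two_sided_cayley_def)
  have lrG: "l \<in> carrier G" "r \<in> carrier G" using lr L R by auto
  have "x = l \<otimes> y \<otimes> inv r"
    using lrG x by (simp add: lr(3) m_assoc)
  then have "x \<in> (L #> y) <#> set_inv R"
    using lr(1,2) by (auto simp: r_coset_def set_mult_def SET_INV_def)
  then show ?thesis
    using P y by (simp add: two_sided_cayley_property_def arc_iff)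
qed

text \<open>
  If \<open>inv l \<otimes> r = \<one>\<close>, then \<open>l = r\<close> is a common element of \<open>L\<close> and \<open>R\<close>, although even the
  conjugates of \<open>L\<close> are disjoint from \<open>R\<close>.
\<close>

lemma one_notin_S:
  assumes "two_sided_cayley_property G L R"
  shows "\<one> \<notin> S"
proof
  assume "\<one> \<in> S"
  then obtain l r where lr: "l \<in> L" "r \<in> R" "inv l \<otimes> r = \<one>"
    by (auto simp: set_mult_def SET_INV_def)
  then have "l = r"
    using L R by (metis inv_closed inv_equality inv_inv subsetD)
  moreover have "set_conj G L \<one> = L"
    using L by (simp add: set_conj_def lcos_mult_one)
  moreover have "set_conj G L \<one> \<inter> R = {}"
    using assms by (simp add: two_sided_cayley_property_def)
  ultimately show False
    using lr by blast
qed

text \<open>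
  Reversing the arc \<open>(\<one>, s)\<close> gives \<open>(s, \<one>)\<close>, and the quotient of its end points, formed on
  either side, is \<open>inv s\<close>.
\<close>

lemma inv_mem_S:
  assumes P: "two_sided_cayley_property G L R"
    and reg: "subgroup (right_regular G) (graph_Aut \<Gamma>) \<or> subgroup (left_regular G) (graph_Aut \<Gamma>)"
    and s: "s \<in> S"
  shows "inv s \<in> S"
proof -
  have sG: "s \<in> carrier G" using s S_subset by blast
  have "(\<one>, s) \<in> parcs \<Gamma>"
    using s by (simp add: arc_one_iff)
  then have "(s, \<one>) \<in> parcs \<Gamma>"
    by (rule arc_sym[OF P])
  from reg show ?thesis
  proof
    assume "subgroup (right_regular G) (graph_Aut \<Gamma>)"
    then have "\<one> \<otimes> inv s \<in> S"
      using \<open>(s, \<one>) \<in> parcs \<Gamma>\<close> sG one_closed unfolding right_regular_iff_arcs by blast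
    then show ?thesis using sG by simp
  next
    assume "subgroup (left_regular G) (graph_Aut \<Gamma>)"
    then have "inv s \<otimes> \<one> \<in> S"
      using \<open>(s, \<one>) \<in> parcs \<Gamma>\<close> sG one_closed unfolding left_regular_iff_arcs by blast
    then show ?thesis using sG by simp
  qed
qed

lemma connection_set_S:
  assumes "two_sided_cayley_property G L R"
    and "subgroup (right_regular G) (graph_Aut \<Gamma>) \<or> subgroup (left_regular G) (graph_Aut \<Gamma>)"
  shows "connection_set G S"
  unfolding connection_set_def
  using S_subset one_notin_S[OF assms(1)] set_inv_eqI[OF S_subset inv_mem_S[OF assms]] by simp

text \<open>
  The two graphs test \<open>y \<otimes> inv x\<close> and \<open>x \<otimes> inv y\<close> for membership in \<open>S\<close>; these are inverse to
  each other, and \<open>S\<close> is closed under inverses.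
\<close>

lemma eq_cayley_graph:
  assumes "two_sided_cayley_property G L R"
    and reg: "subgroup (right_regular G) (graph_Aut \<Gamma>)"
  shows "\<Gamma> = cayley_graph G S"
proof -
  have S: "connection_set G S"
    using assms by (intro connection_set_S) auto
  have "(x, y) \<in> parcs \<Gamma> \<longleftrightarrow> x \<otimes> inv y \<in> S" if "x \<in> carrier G" "y \<in> carrier G" for x y
  proof -
    have "inv (x \<otimes> inv y) = y \<otimes> inv x" using that by (simp add: inv_mult_group)
    then show ?thesis
      using reg that connection_set_inv_mem_iff[OF S, of "x \<otimes> inv y"]
      by (simp add: right_regular_iff_arcs)
  qed
  then have "parcs \<Gamma> = parcs (cayley_graph G S)"
    by (auto simp: two_sided_cayley_def cayley_graph_def)
  then show ?thesis
    by (intro pair_pre_digraph.equality) simp_all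
qed

text \<open>
  Inversion turns \<open>inv x \<otimes> y\<close>, which decides adjacency here, into the quotient \<open>inv x \<otimes> inv
  (inv y)\<close> that decides adjacency of \<open>inv x\<close> and \<open>inv y\<close> in the Cayley graph.
\<close>

lemma iso_cayley_graph:
  assumes reg: "subgroup (left_regular G) (graph_Aut \<Gamma>)"
  shows "digraph_iso (with_proj \<Gamma>) (with_proj (cayley_graph G S))"
proof (rule digraph_iso_with_projI)
  show "bij_betw (\<lambda>x. inv x) (pverts \<Gamma>) (pverts (cayley_graph G S))"
    by (rule bij_betw_byWitness[of _ "\<lambda>x. inv x"]) auto
  show "(inv x, inv y) \<in> parcs (cayley_graph G S) \<longleftrightarrow> (x, y) \<in> parcs \<Gamma>"
    if "x \<in> pverts \<Gamma>" "y \<in> pverts \<Gamma>" for x y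
    using reg that by (simp add: left_regular_iff_arcs) (simp add: cayley_graph_def)
qed (rule pair_wf_two_sided_cayley pair_wf_cayley_graph)+

end

section \<open>Regular representations as groups of automorphisms\<close>

theorem theorem1p9:
  fixes G :: "('a, 'm) monoid_scheme" (structure)
    and L R :: "'a set"
    and \<Gamma> :: "'a pair_pre_digraph"
  assumes "group G"
    and "L \<subseteq> carrier G" and "R \<subseteq> carrier G"
    and "two_sided_cayley_property G L R"
  defines "\<Gamma> \<equiv> two_sided_cayley G L R"
  shows "(subgroup (right_regular G) (graph_Aut \<Gamma>) \<longleftrightarrow>
            (\<forall>g\<in>carrier G. (set_inv L #> g) <#> R = (set_inv L <#> R) #> g)) \<and>
         (subgroup (right_regular G) (graph_Aut \<Gamma>) \<longrightarrow>
            connection_set G (set_inv L <#> R) \<and>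
            \<Gamma> = cayley_graph G (set_inv L <#> R)) \<and>
         (subgroup (left_regular G) (graph_Aut \<Gamma>) \<longleftrightarrow>
            (\<forall>g\<in>carrier G. (set_inv L #> g) <#> R = (g <# set_inv L) <#> R)) \<and>
         (subgroup (left_regular G) (graph_Aut \<Gamma>) \<longrightarrow>
            connection_set G (set_inv R <#> L) \<and>
            digraph_iso (with_proj \<Gamma>) (with_proj (cayley_graph G (set_inv R <#> L))))"
proof -
  interpret two_sided_connection G L R
    using assms(1-3) by (simp add: two_sided_connection_def two_sided_connection_axioms_def)
  note P = \<open>two_sided_cayley_property G L R\<close>
  \<comment> \<open>The Cayley graph for left translations has connection set \<open>R\<^sup>-\<^sup>1 L\<close>, the inverse of the inverse-closed set \<open>L\<^sup>-\<^sup>1 R\<close>.\<close>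
  have S_eq: "set_inv R <#> L = set_inv L <#> R" if "connection_set G (set_inv L <#> R)"
    using that set_inv_set_inv_mult[OF L R] by (simp add: connection_set_def)
  show ?thesis
    unfolding \<Gamma>_def
  proof (intro conjI impI)
    assume "subgroup (right_regular G) (graph_Aut (two_sided_cayley G L R))"
    then show "connection_set G (set_inv L <#> R)"
      and "two_sided_cayley G L R = cayley_graph G (set_inv L <#> R)"
      using P connection_set_S eq_cayley_graph by auto
  next
    assume reg: "subgroup (left_regular G) (graph_Aut (two_sided_cayley G L R))"
    then have S: "connection_set G (set_inv L <#> R)"
      using P connection_set_S by simp
    then show "connection_set G (set_inv R <#> L)"
      by (simp add: S_eq)
    show "digraph_iso (with_proj (two_sided_cayley G L R))
        (with_proj (cayley_graph G (set_inv R <#> L)))"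
      using iso_cayley_graph[OF reg] S by (simp add: S_eq)
  qed (rule right_regular_iff left_regular_iff)+
qed

end
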